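(* For every integer $n\ge 1$, \[\overline{p}(5n)\equiv (-1)^n\, r_3(n) \pmod 5.\]
   Context: An overpartition of a nonnegative integer $n$ is a partition of $n$ in which the first occurrence of each distinct part may (or may not) be overlined; $\overline{p}(n)$ denotes the number of overpartitions of $n$ (with $\overline{p}(0)=1$). Equivalently, $\sum_{n\ge0}\overline{p}(n)q^n=\prod_{k\ge1}\frac{1+q^k}{1-q^k}=1/\varphi(-q)$, where $\varphi(q)=\sum_{n=-\infty}^{\infty}q^{n^2}$. For an integer $k\ge1$, $r_k(n)$ denotes the number of representations of $n$ as an ordered sum of $k$ squares of integers, i.e. the number of $(x_1,\dots,x_k)\in\mathbb{Z}^k$ with $x_1^2+\cdots+x_k^2=n$. *)

theory Defs
  imports Main "HOL-Library.Multiset" "HOL-Number_Theory.Cong"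
begin

text \<open>An overpartition of n: a partition P of n (multiset of positive parts summing to n)
  together with the set O of distinct parts whose first occurrence is overlined.\<close>
definition overpartitions :: "nat \<Rightarrow> (nat multiset \<times> nat set) set" where
  "overpartitions n = {(P, Ov). (\<forall>x\<in>#P. 0 < x) \<and> sum_mset P = n \<and> Ov \<subseteq> set_mset P}"

definition overpartition_count :: "nat \<Rightarrow> nat" where
  "overpartition_count n = card (overpartitions n)"

definition sq_reps :: "nat \<Rightarrow> nat \<Rightarrow> nat" where
  "sq_reps k n = card {x :: nat \<Rightarrow> int. (\<forall>i\<ge>k. x i = 0) \<and> (\<Sum>i<k. (x i)^2) = int n}"

end

theory Submission
  imports Defs "HOL-Computational_Algebra.Formal_Power_Series"
begin

text \<open>
  Let \<open>G\<^sub>m\<close> be the generating function of overpartitions with parts at most \<open>m\<close>. From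
  \<open>(1 - q\<^sup>m) G\<^sub>m = (1 + q\<^sup>m) G\<^sub>m\<^sub>-\<^sub>1\<close> one gets by telescoping a Shanks-type finite identity for
  \<open>G\<^sub>n (1 + 2 \<Sum>\<^bsub>1 \<le> j \<le> n\<^esub> (-1)\<^sup>j q\<^bsup>j\<^sup>2\<^esup>)\<close> whose right-hand side is \<open>1 + O(q\<^bsup>n+1\<^esup>)\<close>; hence
  \<open>P \<phi>(-q) = 1\<close> for the generating function \<open>P\<close> of all overpartitions.

  Modulo 5 we have \<open>\<phi>(-q)\<^sup>5 \<equiv> \<phi>(-q\<^sup>5)\<close>, so \<open>P \<phi>(-q\<^sup>5) \<equiv> \<phi>(-q)\<^sup>4\<close>. Extracting the exponents divisible
  by 5 turns the left-hand side into \<open>Q \<phi>(-q)\<close>, where \<open>Q\<close> generates the overpartition numbers of \<open>5n\<close>,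
  and leaves the right-hand side unchanged modulo 5 because \<open>r\<^sub>4(5n) \<equiv> r\<^sub>4(n)\<close>. Dividing by
  \<open>\<phi>(-q)\<close> gives \<open>Q \<equiv> \<phi>(-q)\<^sup>3\<close>.

  For \<open>r\<^sub>4(5n) \<equiv> r\<^sub>4(n)\<close>, consider the six quaternions \<open>1 \<plusminus> 2i\<close>, \<open>1 \<plusminus> 2j\<close>, \<open>1 \<plusminus> 2k\<close> of norm 5. An
  integral quaternion of norm \<open>5n\<close> is left divisible by exactly one of them, or by all six if it is
  divisible by 5; counting the pairs (divisor, quotient) gives \<open>6 r\<^sub>4(n) \<equiv> r\<^sub>4(5n)\<close>.
\<close>

unbundle fps_syntax

section \<open>Sums of squares\<close>

lemma finite_int_square_roots: "finite {j::int. j\<^sup>2 = int n}"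
proof (rule finite_subset)
  show "{j::int. j\<^sup>2 = int n} \<subseteq> {- int n..int n}"
  proof
    fix j :: int assume "j \<in> {j. j\<^sup>2 = int n}"
    hence "\<bar>j\<bar> * \<bar>j\<bar> = int n" by (simp add: power2_eq_square)
    moreover have "\<bar>j\<bar> \<le> \<bar>j\<bar> * \<bar>j\<bar>" by (cases "j = 0") (simp_all add: mult_le_cancel_right1 del: abs_mult_self_eq)
    ultimately show "j \<in> {- int n..int n}" by auto
  qed
qed simp

definition square_vectors :: "nat \<Rightarrow> nat \<Rightarrow> (nat \<Rightarrow> int) set" where
  "square_vectors k n = {x. (\<forall>i\<ge>k. x i = 0) \<and> (\<Sum>i<k. (x i)\<^sup>2) = int n}"

text \<open>Peels off the last coordinate \<open>j\<close>. The redundant \<open>i = j^2\<close>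
  grades the source so that its cardinality is a Cauchy product.\<close>

lemma bij_betw_square_vectors_Suc:
  "bij_betw (\<lambda>(i, j, x). x(k := j))
     (SIGMA i:{..n}. {j::int. j\<^sup>2 = int i} \<times> square_vectors k (n - i)) (square_vectors (Suc k) n)"
  (is "bij_betw ?f ?T ?R")
proof (rule bij_betw_byWitness[where f' = "\<lambda>x. (nat ((x k)\<^sup>2), x k, x(k := 0))"])
  show "?f ` ?T \<subseteq> ?R"
    by (auto simp: square_vectors_def of_nat_diff)
  show "(\<lambda>x. (nat ((x k)\<^sup>2), x k, x(k := 0))) ` ?R \<subseteq> ?T"
  proof
    fix y assume "y \<in> (\<lambda>x. (nat ((x k)\<^sup>2), x k, x(k := 0))) ` ?R"
    then obtain x where x: "x \<in> ?R" and y: "y = (nat ((x k)\<^sup>2), x k, x(k := 0))"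
      by blast
    have s: "(\<Sum>i<k. (x i)\<^sup>2) + (x k)\<^sup>2 = int n" and z: "\<forall>i\<ge>Suc k. x i = 0"
      using x by (auto simp: square_vectors_def)
    have "(\<Sum>i<k. (x i)\<^sup>2) \<ge> 0" by (simp add: sum_nonneg)
    hence le: "nat ((x k)\<^sup>2) \<le> n" using s by linarith
    have "(\<Sum>i<k. (x i)\<^sup>2) = int (n - nat ((x k)\<^sup>2))"
      using s le by (simp add: of_nat_diff)
    thus "y \<in> ?T"
      using le z by (auto simp: y square_vectors_def)
  qed
qed (auto simp: square_vectors_def fun_eq_iff)

lemma finite_square_vectors: "finite (square_vectors k n)"
proof (induction k arbitrary: n)
  case 0
  show ?case by (rule finite_subset[of _ "{\<lambda>_. 0}"]) (auto simp: square_vectors_def)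
next
  case (Suc k)
  have "finite (SIGMA i:{..n}. {j::int. j\<^sup>2 = int i} \<times> square_vectors k (n - i))"
    using Suc.IH by (auto simp: finite_int_square_roots)
  thus ?case using bij_betw_finite[OF bij_betw_square_vectors_Suc] by blast
qed

lemma sq_reps_eq_card_square_vectors: "sq_reps k n = card (square_vectors k n)"
  by (simp add: sq_reps_def square_vectors_def)

lemma sq_reps_Suc:
  "sq_reps (Suc k) n = (\<Sum>i\<le>n. card {j::int. j\<^sup>2 = int i} * sq_reps k (n - i))"
proof -
  have "card (square_vectors (Suc k) n)
      = card (SIGMA i:{..n}. {j::int. j\<^sup>2 = int i} \<times> square_vectors k (n - i))"
    by (rule bij_betw_same_card[OF bij_betw_square_vectors_Suc, symmetric])
  thus ?thesis
    by (simp add: sq_reps_eq_card_square_vectors finite_square_vectors finite_int_square_roots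
        card_cartesian_product)
qed

section \<open>Integral quaternions and their left divisors of norm 5\<close>

definition four_squares :: "nat \<Rightarrow> (int \<times> int \<times> int \<times> int) set" where
  "four_squares n = {(a, b, c, d). a\<^sup>2 + b\<^sup>2 + c\<^sup>2 + d\<^sup>2 = int n}"

lemma bij_betw_four_squares:
  "bij_betw (\<lambda>x :: nat \<Rightarrow> int. (x 0, x 1, x 2, x 3)) (square_vectors 4 n) (four_squares n)"
  (is "bij_betw ?f ?R _")
proof -
  let ?g = "\<lambda>(a, b, c, d) i :: nat. if i = 0 then a else if i = 1 then b else if i = 2 then c
              else if i = 3 then d else 0 :: int"
  have sum4: "(\<Sum>i<4. (x i)\<^sup>2) = (x 0)\<^sup>2 + (x 1)\<^sup>2 + (x 2)\<^sup>2 + (x 3)\<^sup>2" for x :: "nat \<Rightarrow> int"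
    by (simp add: eval_nat_numeral)
  show "bij_betw ?f ?R (four_squares n)"
  proof (rule bij_betw_byWitness[where f' = ?g])
    show "\<forall>x\<in>?R. ?g (?f x) = x"
    proof
      fix x assume "x \<in> ?R"
      hence "x i = 0" if "i \<ge> 4" for i using that unfolding square_vectors_def by blast
      moreover have "\<forall>i. i = 0 \<or> i = 1 \<or> i = 2 \<or> i = 3 \<or> i \<ge> (4::nat)" by (intro allI) linarith
      ultimately have "?g (?f x) i = x i" for i
        by (elim allE[of _ i] disjE) simp_all
      thus "?g (?f x) = x" by blast
    qed
    show "\<forall>v\<in>four_squares n. ?f (?g v) = v" by auto
    show "?f ` ?R \<subseteq> four_squares n"
      unfolding sum4 square_vectors_def four_squares_def by blast
    show "?g ` four_squares n \<subseteq> ?R"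
      unfolding sum4 square_vectors_def four_squares_def by auto
  qed
qed

lemma finite_four_squares: "finite (four_squares n)"
  using bij_betw_finite[OF bij_betw_four_squares[of n]] finite_square_vectors[of 4 n] by simp

lemma card_four_squares: "card (four_squares n) = sq_reps 4 n"
  using bij_betw_same_card[OF bij_betw_four_squares[of n]] by (simp add: sq_reps_eq_card_square_vectors)

text \<open>For \<open>s = \<plusminus>1\<close>, \<open>left_divisible s (a, b, c, d)\<close> says that the quaternion \<open>a + bi + cj + dk\<close> has the
  form \<open>(1 + 2si) y\<close> with integral \<open>y\<close>. Composing with \<open>rot\<close> replaces \<open>1 + 2si\<close> by \<open>1 + 2sj\<close> and
  \<open>1 + 2sk\<close>.\<close>

definition left_divisible :: "int \<Rightarrow> int \<times> int \<times> int \<times> int \<Rightarrow> bool" where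
  "left_divisible s = (\<lambda>(a, b, c, d). 5 dvd b - 2 * s * a \<and> 5 dvd d - 2 * s * c)"

definition rot :: "int \<times> int \<times> int \<times> int \<Rightarrow> int \<times> int \<times> int \<times> int" where
  "rot = (\<lambda>(a, b, c, d). (a, c, d, b))"

text \<open>\<open>?f\<close> is left multiplication by \<open>1 + 2si\<close>, which multiplies the
  norm by 5; its inverse \<open>?g\<close> multiplies by the conjugate \<open>1 - 2si\<close> and
  divides by 5.\<close>

lemma card_left_divisible:
  assumes s: "s = 1 \<or> s = -1"
  shows "card {v \<in> four_squares (5 * n). left_divisible s v} = card (four_squares n)"
proof -
  let ?f = "\<lambda>(a, b, c, d). (a - 2 * s * b, b + 2 * s * a, c - 2 * s * d, d + 2 * s * c)"
  let ?g = "\<lambda>(a, b, c, d). ((a + 2 * s * b) div 5, (b - 2 * s * a) div 5,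
                             (c + 2 * s * d) div 5, (d - 2 * s * c) div 5)"
  have ss: "s * s = 1" "s * (s * x) = x" for x using s by auto
  have sub: "?f ` four_squares n \<subseteq> {v \<in> four_squares (5 * n). left_divisible s v}"
  proof (clarsimp simp: four_squares_def left_divisible_def, intro conjI)
    fix a b c d :: int assume *: "a\<^sup>2 + b\<^sup>2 + c\<^sup>2 + d\<^sup>2 = int n"
    have "(a - 2 * s * b)\<^sup>2 + (b + 2 * s * a)\<^sup>2 + (c - 2 * s * d)\<^sup>2 + (d + 2 * s * c)\<^sup>2
        = 5 * (a\<^sup>2 + b\<^sup>2 + c\<^sup>2 + d\<^sup>2)"
      using s by (auto simp: power2_eq_square algebra_simps)
    thus "(a - 2 * s * b)\<^sup>2 + (b + 2 * s * a)\<^sup>2 + (c - 2 * s * d)\<^sup>2 + (d + 2 * s * c)\<^sup>2 = 5 * int n"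
      using * by simp
    show "5 dvd b + 2 * s * a - 2 * s * (a - 2 * s * b)" "5 dvd d + 2 * s * c - 2 * s * (c - 2 * s * d)"
      by (simp_all add: algebra_simps ss)
  qed
  have gf: "\<forall>v\<in>four_squares n. ?g (?f v) = v"
    by (auto simp: algebra_simps ss)
  have inv: "?f (?g v) = v \<and> ?g v \<in> four_squares n"
    if "v \<in> four_squares (5 * n)" "left_divisible s v" for v
  proof -
    obtain a b c d where v: "v = (a, b, c, d)" by (cases v) auto
    \<comment> \<open>These two divisibilities suffice: they give
      \<open>a + 2 * s * b = 5 * (a + 2 * s * y)\<close>, and likewise for \<open>c\<close> and
      \<open>d\<close>.\<close>
    from that(2) obtain y w where "b - 2 * s * a = 5 * y" "d - 2 * s * c = 5 * w"
      by (auto simp: v left_divisible_def elim!: dvdE)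
    hence bd: "b = 5 * y + 2 * s * a" "d = 5 * w + 2 * s * c" by auto
    have g: "?g v = (a + 2 * s * y, y, c + 2 * s * w, w)"
      by (auto simp: v bd algebra_simps ss)
    have "a\<^sup>2 + b\<^sup>2 + c\<^sup>2 + d\<^sup>2 = 5 * ((a + 2 * s * y)\<^sup>2 + y\<^sup>2 + (c + 2 * s * w)\<^sup>2 + w\<^sup>2)"
      using s by (auto simp: bd power2_eq_square algebra_simps)
    hence "?g v \<in> four_squares n"
      using that(1) unfolding g by (simp add: v four_squares_def)
    moreover have "?f (?g v) = v"
      unfolding g by (auto simp: v bd algebra_simps ss)
    ultimately show ?thesis by blast
  qed
  have "bij_betw ?f (four_squares n) {v \<in> four_squares (5 * n). left_divisible s v}"
    by (rule bij_betw_byWitness[where f' = ?g]) (use gf sub inv in blast)+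
  from bij_betw_same_card[OF this] show ?thesis by (rule sym)
qed

text \<open>\<open>rot\<close> permutes the imaginary coordinates cyclically and so keeps the norm.
  This carries the count for \<open>1 + 2si\<close> over to \<open>1 + 2sj\<close> and
  \<open>1 + 2sk\<close>.\<close>

lemma card_four_squares_rot:
  "card {v \<in> four_squares n. P (rot v)} = card {v \<in> four_squares n. P v}"
proof -
  have "bij_betw rot {v \<in> four_squares n. P (rot v)} {v \<in> four_squares n. P v}"
    by (rule bij_betw_byWitness[where f' = "rot \<circ> rot"])
       (auto simp: rot_def four_squares_def add_ac)
  thus ?thesis by (rule bij_betw_same_card)
qed

definition divisor_count :: "int \<times> int \<times> int \<times> int \<Rightarrow> nat" where
  "divisor_count v = (\<Sum>s\<in>{1, -1}. of_bool (left_divisible s v) + of_bool (left_divisible s (rot v))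
     + of_bool (left_divisible s (rot (rot v))))"

text \<open>The count depends only on the coordinates modulo 5, so evaluating it on the 5^4 residue
  vectors is enough.\<close>

lemma divisor_count_cong_1:
  assumes "v \<in> four_squares (5 * n)"
  shows "[divisor_count v = 1] (mod 5)"
proof -
  have check: "\<forall>a\<in>set [0..4]. \<forall>b\<in>set [0..4]. \<forall>c\<in>set [0..4]. \<forall>d\<in>set [0..4].
      (a * a + b * b + c * c + d * d) mod 5 = 0 \<longrightarrow> divisor_count (a, b, c, d) mod 5 = 1"
    unfolding divisor_count_def left_divisible_def rot_def by code_simp
  obtain a b c d where v: "v = (a, b, c, d)" by (cases v) auto
  have mod5: "(x mod 5 - 2 * s * (y mod 5)) mod 5 = (x - 2 * s * y) mod 5" for x y s :: int
    unfolding cong_def[symmetric] by (intro cong_diff cong_mult cong_refl) (simp_all add: cong_def)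
  have red: "divisor_count (a mod 5, b mod 5, c mod 5, d mod 5) = divisor_count (a, b, c, d)"
    unfolding divisor_count_def left_divisible_def rot_def dvd_eq_mod_eq_0 prod.case
    by (simp only: mod5)
  have mem: "x mod 5 \<in> set [0..4]" for x :: int
    by simp
  have "[a mod 5 * (a mod 5) + b mod 5 * (b mod 5) + c mod 5 * (c mod 5) + d mod 5 * (d mod 5)
      = a * a + b * b + c * c + d * d] (mod 5)"
    by (intro cong_add cong_mult) (simp_all add: cong_def)
  moreover have "(a * a + b * b + c * c + d * d) mod 5 = 0"
    using assms by (simp add: v four_squares_def power2_eq_square)
  ultimately have "(a mod 5 * (a mod 5) + b mod 5 * (b mod 5) + c mod 5 * (c mod 5)
      + d mod 5 * (d mod 5)) mod 5 = 0"
    by (simp only: cong_def)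
  hence "divisor_count (a mod 5, b mod 5, c mod 5, d mod 5) mod 5 = 1"
    by (rule check[rule_format, OF mem mem mem mem])
  thus ?thesis by (simp add: red v cong_def)
qed

lemma sq_reps_4_cong: "[sq_reps 4 (5 * n) = sq_reps 4 n] (mod 5)"
proof -
  let ?V = "four_squares (5 * n)"
  have count: "(\<Sum>v\<in>?V. of_bool (P v)) = card {v \<in> ?V. P v}" for P
    by (simp add: finite_four_squares Int_def)
  have "[(\<Sum>v\<in>?V. divisor_count v) = (\<Sum>v\<in>?V. 1)] (mod 5)"
    by (intro cong_sum divisor_count_cong_1)
  \<comment> \<open>Summed over \<open>?V\<close>, each of the six indicators counts the multiples
    of one fixed divisor.\<close>
  moreover have "(\<Sum>v\<in>?V. divisor_count v) = 6 * card (four_squares n)"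
    by (simp add: divisor_count_def sum.distrib count card_left_divisible
        card_four_squares_rot[of _ "\<lambda>v. left_divisible _ (rot v)"]
        card_four_squares_rot[of _ "left_divisible _"] del: sum_of_bool_eq)
  ultimately have "[6 * sq_reps 4 n = sq_reps 4 (5 * n)] (mod 5)"
    by (simp add: card_four_squares)
  moreover have "[6 * k = k] (mod 5)" for k :: nat
    using mod_mult_self2[of k 5 k] by (simp add: cong_def)
  ultimately show ?thesis by (metis cong_sym cong_trans)
qed

section \<open>A finite form of Gauss's square identity\<close>

text \<open>With \<open>H = G (Suc M) + G M\<close> and \<open>p = q ^ Suc M\<close>, the recurrence
  gives \<open>(1 - p) * H = 2 * G M\<close> and \<open>(1 + p) * H = 2 * G (Suc M)\<close>. So the
  terms added at step \<open>M\<close> cancel the old remainder and leave the next one.\<close>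

lemma telescoping_square_sum:
  fixes q :: "'a::comm_ring_1" and G :: "nat \<Rightarrow> 'a"
  assumes G0: "G 0 = 1"
    and G_Suc: "\<And>m. (1 - q ^ Suc m) * G (Suc m) = (1 + q ^ Suc m) * G m"
  shows "(1 - q ^ m) * (1 + (\<Sum>s<M. (-1) ^ Suc s * q ^ (Suc s * Suc m) * (G (Suc s) + G s)))
       - (1 + q ^ m) * (1 + (\<Sum>s<M. (-1) ^ Suc s * q ^ (Suc s * m) * (G (Suc s) + G s)))
       = - 2 * (-1) ^ M * q ^ (Suc M * m) * G M"
proof (induction M)
  case 0
  show ?case by (simp add: G0 algebra_simps)
next
  case (Suc M)
  define H where "H = G (Suc M) + G M"
  define p where "p = q ^ Suc M"
  define r where "r = q ^ m"
  define e where "e = (-1 :: 'a) ^ Suc M * q ^ (Suc M * m)"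
  have p: "(1 - p) * G (Suc M) = (1 + p) * G M"
    using G_Suc[of M] by (simp add: p_def)
  have H1: "(1 - p) * H = 2 * G M"
    using p unfolding H_def by (simp add: algebra_simps)
  have H2: "(1 + p) * H = 2 * G (Suc M)"
    using p unfolding H_def by (simp add: algebra_simps)
  have "(1 - r) * (e * p * H) - (1 + r) * (e * H) = - e * ((1 - p) * H) - e * r * ((1 + p) * H)"
    by (simp add: algebra_simps)
  also have "\<dots> = - 2 * e * G M - 2 * e * r * G (Suc M)"
    unfolding H1 H2 by (simp add: algebra_simps)
  finally have step: "(1 - r) * (e * p * H) - (1 + r) * (e * H)
      = - 2 * e * G M - 2 * e * r * G (Suc M)" .
  have e1: "(-1) ^ Suc M * q ^ (Suc M * Suc m) * (G (Suc M) + G M) = e * p * H"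
    by (simp add: e_def p_def H_def power_add mult_ac)
  have e2: "(-1) ^ Suc M * q ^ (Suc M * m) * (G (Suc M) + G M) = e * H"
    by (simp add: e_def H_def)
  have e3: "- 2 * (-1) ^ M * q ^ (Suc M * m) * G M = 2 * e * G M"
    by (simp add: e_def)
  have e4: "- 2 * (-1) ^ Suc M * q ^ (Suc (Suc M) * m) * G (Suc M) = - 2 * e * r * G (Suc M)"
    by (simp add: e_def r_def power_add mult_ac)
  define A where "A = (\<Sum>s<M. (-1) ^ Suc s * q ^ (Suc s * Suc m) * (G (Suc s) + G s))"
  define B where "B = (\<Sum>s<M. (-1) ^ Suc s * q ^ (Suc s * m) * (G (Suc s) + G s))"
  have "(1 - r) * (1 + A) - (1 + r) * (1 + B) = 2 * e * G M"
    using Suc.IH unfolding A_def B_def r_def e3 .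
  moreover have "(1 - r) * (1 + (A + e * p * H)) - (1 + r) * (1 + (B + e * H))
      = ((1 - r) * (1 + A) - (1 + r) * (1 + B)) + ((1 - r) * (e * p * H) - (1 + r) * (e * H))"
    by (simp add: algebra_simps)
  ultimately have "(1 - r) * (1 + (A + e * p * H)) - (1 + r) * (1 + (B + e * H))
      = - 2 * e * r * G (Suc M)"
    using step by simp
  thus ?case
    unfolding sum.lessThan_Suc e1 e2 e4 A_def B_def r_def .
qed

text \<open>\<open>G m\<close> stands for the product of \<open>(1 + q^k) / (1 - q^k)\<close> over
  \<open>1 \<le> k \<le> m\<close>, given without division. Induction on \<open>n\<close> compares
  consecutive right-hand sides by telescoping and then cancels \<open>1 - q ^ m\<close>.\<close>

lemma finite_Gauss_square_identity:
  fixes q :: "'a::idom" and G :: "nat \<Rightarrow> 'a"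
  assumes G0: "G 0 = 1"
    and G_Suc: "\<And>m. (1 - q ^ Suc m) * G (Suc m) = (1 + q ^ Suc m) * G m"
    and q: "\<And>m. q ^ Suc m \<noteq> 1"
  shows "G n * (1 + (\<Sum>j=1..n. 2 * (-1) ^ j * q ^ j\<^sup>2))
       = 1 + (\<Sum>s<n. (-1) ^ Suc s * q ^ (Suc s * Suc n) * (G (Suc s) + G s))"
proof (induction n)
  case 0
  show ?case by (simp add: G0)
next
  case (Suc n)
  define m where "m = Suc n"
  define S where "S = 1 + (\<Sum>j=1..n. 2 * (-1) ^ j * q ^ j\<^sup>2)"
  define F where "F = 1 + (\<Sum>s<n. (-1) ^ Suc s * q ^ (Suc s * m) * (G (Suc s) + G s))"
  define F' where "F' = 1 + (\<Sum>s<m. (-1) ^ Suc s * q ^ (Suc s * Suc m) * (G (Suc s) + G s))"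
  define e where "e = (-1 :: 'a) ^ m * q ^ m\<^sup>2"
  have IH: "G n * S = F"
    using Suc.IH by (simp add: S_def F_def m_def)
  have rec: "(1 - q ^ m) * G m = (1 + q ^ m) * G n"
    using G_Suc[of n] by (simp add: m_def)
  have H: "(1 + q ^ m) * (G m + G n) = 2 * G m"
    using rec by (simp add: algebra_simps)
  \<comment> \<open>Taking \<open>M = m\<close> gives the lower sum one term more than
    \<open>F\<close>; its exponent \<open>m * m\<close> is the new square.\<close>
  have "(1 - q ^ m) * F' - (1 + q ^ m) * (F + e * (G m + G n)) = - 2 * e * q ^ m * G m"
    using telescoping_square_sum[OF G0 G_Suc, of m m]
    by (simp add: F_def F'_def e_def m_def power2_eq_square power_add mult_ac add_ac)
  hence "(1 - q ^ m) * F' = (1 + q ^ m) * F + e * ((1 + q ^ m) * (G m + G n)) - 2 * e * q ^ m * G m"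
    by (simp add: algebra_simps)
  also have "\<dots> = ((1 + q ^ m) * G n) * S + 2 * e * G m * (1 - q ^ m)"
    unfolding H IH[symmetric] by (simp add: algebra_simps)
  also have "\<dots> = (1 - q ^ m) * (G m * (S + 2 * e))"
    unfolding rec[symmetric] by (simp add: algebra_simps)
  finally have "F' = G m * (S + 2 * e)"
    using q[of n] by (simp add: m_def)
  thus ?case
    by (simp add: F'_def S_def e_def m_def add_ac mult_ac)
qed

section \<open>The generating function of overpartitions\<close>

definition bounded_overpartitions :: "nat \<Rightarrow> nat \<Rightarrow> (nat multiset \<times> nat set) set" where
  "bounded_overpartitions m n = {(P, Ov) \<in> overpartitions n. set_mset P \<subseteq> {..m}}"

lemma bounded_overpartitions_eq_overpartitions:
  assumes "n \<le> m"
  shows "bounded_overpartitions m n = overpartitions n"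
proof -
  have "x \<le> m" if "x \<in># P" "sum_mset P = n" for x :: nat and P
    using that assms by (auto dest!: multi_member_split)
  thus ?thesis
    by (auto simp: bounded_overpartitions_def overpartitions_def)
qed

lemma bounded_overpartitions_0:
  "bounded_overpartitions 0 n = (if n = 0 then {({#}, {})} else {})"
proof -
  have "(P, Ov) \<in> bounded_overpartitions 0 n \<longleftrightarrow> P = {#} \<and> Ov = {} \<and> n = 0" for P Ov
  proof
    assume *: "(P, Ov) \<in> bounded_overpartitions 0 n"
    have "x \<notin># P" for x
      using * by (fastforce simp: bounded_overpartitions_def overpartitions_def)
    hence "P = {#}" by (meson multiset_nonemptyE)
    with * show "P = {#} \<and> Ov = {} \<and> n = 0"
      by (auto simp: bounded_overpartitions_def overpartitions_def)
  qed (auto simp: bounded_overpartitions_def overpartitions_def)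
  thus ?thesis by auto
qed

text \<open>The three pieces: no part \<open>Suc m\<close>; a single overlined part \<open>Suc m\<close>; and the rest,
  where one copy of \<open>Suc m\<close> can be removed without affecting the overlining.\<close>

lemma bounded_overpartitions_Suc:
  "bounded_overpartitions (Suc m) n =
     bounded_overpartitions m n \<union>
     (if Suc m \<le> n
      then (\<lambda>(P, Ov). (add_mset (Suc m) P, Ov)) ` bounded_overpartitions (Suc m) (n - Suc m) \<union>
           (\<lambda>(P, Ov). (add_mset (Suc m) P, insert (Suc m) Ov)) ` bounded_overpartitions m (n - Suc m)
      else {})" (is "?A = ?B")
proof (intro equalityI subsetI)
  fix x assume x: "x \<in> ?A"
  obtain P Ov where [simp]: "x = (P, Ov)" by force
  show "x \<in> ?B"
  proof (cases "Suc m \<in># P")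
    case False
    hence "set_mset P \<subseteq> {..m}"
      using x by (auto simp: bounded_overpartitions_def le_Suc_eq)
    thus ?thesis using x by (auto simp: bounded_overpartitions_def)
  next
    case True
    then obtain Q where P: "P = add_mset (Suc m) Q"
      by (meson mset_add)
    have le: "Suc m \<le> n"
      using x by (auto simp: P bounded_overpartitions_def overpartitions_def)
    show ?thesis
    proof (cases "Suc m \<in> Ov \<and> Suc m \<notin># Q")
      case True
      have "set_mset Q \<subseteq> {..m}"
        using x True by (auto simp: P bounded_overpartitions_def le_Suc_eq)
      hence "(Q, Ov - {Suc m}) \<in> bounded_overpartitions m (n - Suc m)"
        using x by (auto simp: P bounded_overpartitions_def overpartitions_def)
      moreover have "x = (\<lambda>(P, Ov). (add_mset (Suc m) P, insert (Suc m) Ov)) (Q, Ov - {Suc m})"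
        using True by (auto simp: P)
      ultimately have "x \<in> (\<lambda>(P, Ov). (add_mset (Suc m) P, insert (Suc m) Ov)) `
          bounded_overpartitions m (n - Suc m)"
        by (rule rev_image_eqI)
      thus ?thesis unfolding if_P[OF le] by (intro UnI2)
    next
      case False
      hence "(Q, Ov) \<in> bounded_overpartitions (Suc m) (n - Suc m)"
        using x by (auto simp: P bounded_overpartitions_def overpartitions_def)
      moreover have "x = (\<lambda>(P, Ov). (add_mset (Suc m) P, Ov)) (Q, Ov)"
        by (simp add: P)
      ultimately have "x \<in> (\<lambda>(P, Ov). (add_mset (Suc m) P, Ov)) `
          bounded_overpartitions (Suc m) (n - Suc m)"
        by (rule rev_image_eqI)
      thus ?thesis unfolding if_P[OF le] by (intro UnI2 UnI1)
    qed
  qed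
next
  fix x assume "x \<in> ?B"
  thus "x \<in> ?A"
    by (auto simp: bounded_overpartitions_def overpartitions_def split: if_splits)
qed

lemma finite_bounded_overpartitions: "finite (bounded_overpartitions m n)"
proof (induction m arbitrary: n)
  case 0
  show ?case by (simp add: bounded_overpartitions_0)
next
  case (Suc m)
  show ?case
  \<comment> \<open>In the recurrence the bound \<open>Suc m\<close> recurs only at the smaller
    number \<open>n - Suc m\<close>.\<close>
  proof (induction n rule: less_induct)
    case (less n)
    show ?case
      by (subst bounded_overpartitions_Suc) (use Suc.IH less.IH in auto)
  qed
qed

lemma card_bounded_overpartitions_Suc:
  "card (bounded_overpartitions (Suc m) n) = card (bounded_overpartitions m n) +
     (if Suc m \<le> n then card (bounded_overpartitions (Suc m) (n - Suc m)) +
        card (bounded_overpartitions m (n - Suc m)) else 0)"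
proof (cases "Suc m \<le> n")
  case True
  let ?f = "\<lambda>(P, Ov). (add_mset (Suc m) P, Ov)"
  let ?g = "\<lambda>(P, Ov). (add_mset (Suc m) P, insert (Suc m) Ov)"
  let ?A = "bounded_overpartitions m n"
  let ?B = "bounded_overpartitions (Suc m) (n - Suc m)"
  let ?C = "bounded_overpartitions m (n - Suc m)"
  have new: "Suc m \<notin># P" "Suc m \<notin> Ov" if "(P, Ov) \<in> bounded_overpartitions m k" for P Ov k
    using that by (auto simp: bounded_overpartitions_def overpartitions_def)
  have "inj_on ?f ?B"
    by (auto simp: inj_on_def)
  moreover have "inj_on ?g ?C"
    by (rule inj_on_inverseI[where g = "\<lambda>(P, Ov). (P - {#Suc m#}, Ov - {Suc m})"])
       (use new in fastforce)
  \<comment> \<open>A common element would come from the same multiset on both sides: it lacks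
    \<open>Suc m\<close> by \<open>?C\<close>, yet contains it because \<open>Suc m\<close> is
    overlined in \<open>?B\<close>.\<close>
  moreover have "?f ` ?B \<inter> ?g ` ?C = {}"
    using new by (auto simp: bounded_overpartitions_def overpartitions_def)
  moreover have "?A \<inter> (?f ` ?B \<union> ?g ` ?C) = {}"
    by (auto dest: new(1))
  ultimately show ?thesis
    using True by (subst bounded_overpartitions_Suc)
      (simp add: card_Un_disjoint finite_bounded_overpartitions card_image)
next
  case False
  thus ?thesis by (subst bounded_overpartitions_Suc) simp
qed

definition bounded_overpartition_fps :: "nat \<Rightarrow> int fps" where
  "bounded_overpartition_fps m = Abs_fps (\<lambda>n. int (card (bounded_overpartitions m n)))"

lemma bounded_overpartition_fps_0: "bounded_overpartition_fps 0 = 1"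
  by (rule fps_ext) (simp add: bounded_overpartition_fps_def bounded_overpartitions_0)

lemma bounded_overpartition_fps_Suc:
  "(1 - fps_X ^ Suc m) * bounded_overpartition_fps (Suc m)
   = (1 + fps_X ^ Suc m) * bounded_overpartition_fps m"
proof (rule fps_ext)
  fix n
  have "card (bounded_overpartitions (Suc m) n) = card (bounded_overpartitions m n) +
     (if Suc m \<le> n then card (bounded_overpartitions (Suc m) (n - Suc m)) +
        card (bounded_overpartitions m (n - Suc m)) else 0)"
    by (rule card_bounded_overpartitions_Suc)
  thus "((1 - fps_X ^ Suc m) * bounded_overpartition_fps (Suc m)) $ n
     = ((1 + fps_X ^ Suc m) * bounded_overpartition_fps m) $ n"
    unfolding ring_distribs left_diff_distrib mult_1_left fps_sub_nth fps_add_nth fps_X_power_mult_nth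
    by (auto simp: bounded_overpartition_fps_def)
qed

definition overpartition_fps :: "int fps" where
  "overpartition_fps = Abs_fps (\<lambda>n. int (overpartition_count n))"

section \<open>The theta function \<open>\<phi>(-q)\<close>\<close>

text \<open>The sign of \<open>q^(j^2)\<close> may be written \<open>(-1)^n\<close> with
  \<open>n = j^2\<close>, since \<open>j\<close> and \<open>j^2\<close> have the same
  parity.\<close>

definition theta_fps :: "int fps" where
  "theta_fps = Abs_fps (\<lambda>n. (-1) ^ n * int (card {j::int. j\<^sup>2 = int n}))"

lemma fps_const_two_minus_one_power: "(2 * (-1) ^ j :: int fps) = fps_const (2 * (-1) ^ j)"
  by (cases "even j") (simp_all add: numeral_fps_const)

lemma theta_fps_nth_eq_partial_sum:
  assumes "n \<le> N"
  shows "theta_fps $ n = (1 + (\<Sum>j=1..N. 2 * (-1) ^ j * fps_X ^ j\<^sup>2)) $ n"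
proof -
  have [simp]: "(2 * (-1) ^ j * fps_X ^ k :: int fps) $ i = (if i = k then 2 * (-1) ^ j else 0)" for i j k
    unfolding fps_const_two_minus_one_power by (simp add: fps_X_power_iff)
  show ?thesis
  proof (cases "\<exists>k>0. n = k\<^sup>2")
    case True
    then obtain k where k: "k > 0" "n = k\<^sup>2" by blast
    have "{j::int. j\<^sup>2 = int n} = {int k, - int k}"
      by (auto simp: k power2_eq_iff)
    hence "theta_fps $ n = (-1) ^ k * 2"
      using k by (simp add: theta_fps_def minus_one_power_iff)
    moreover have "k \<le> k\<^sup>2" by (simp add: power2_nat_le_imp_le)
    hence "k \<in> {1..N}" using k assms by auto
    hence "(\<Sum>j=1..N. if n = j\<^sup>2 then 2 * (-1) ^ j else 0 :: int) = 2 * (-1) ^ k"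
      by (subst sum.remove[of _ k]) (auto simp: k intro!: sum.neutral)
    ultimately show ?thesis using k by (simp add: fps_sum_nth)
  next
    case False
    hence "n \<noteq> j\<^sup>2" if "j \<in> {1..N}" for j
      using that by (metis atLeastAtMost_iff less_eq_Suc_le One_nat_def)
    hence "(\<Sum>j=1..N. if n = j\<^sup>2 then 2 * (-1) ^ j else 0 :: int) = 0"
      by (intro sum.neutral) simp
    moreover have "theta_fps $ n = (if n = 0 then 1 else 0)"
    proof (cases "n = 0")
      case n: False
      have "j\<^sup>2 \<noteq> int n" for j :: int
      proof
        assume "j\<^sup>2 = int n"
        hence "n = (nat \<bar>j\<bar>)\<^sup>2" by (metis nat_int nat_power_eq abs_ge_zero power2_abs)
        with False n show False by (cases "nat \<bar>j\<bar>") auto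
      qed
      thus ?thesis using n by (simp add: theta_fps_def)
    qed (simp add: theta_fps_def)
    ultimately show ?thesis by (simp add: fps_sum_nth)
  qed
qed

text \<open>Allows both factors to be replaced by truncations when a single coefficient is
  computed.\<close>

lemma fps_mult_nth_cong:
  fixes A B A' B' :: "'a::semiring_1 fps"
  assumes "\<And>i. i \<le> n \<Longrightarrow> A $ i = A' $ i" "\<And>i. i \<le> n \<Longrightarrow> B $ i = B' $ i"
  shows "(A * B) $ n = (A' * B') $ n"
  using assms by (simp add: fps_mult_nth)

lemma fps_power_nth_cong:
  fixes A B :: "'a::semiring_1 fps"
  assumes "\<And>i. i \<le> n \<Longrightarrow> A $ i = B $ i"
  shows "(A ^ k) $ n = (B ^ k) $ n"
  using assms
proof (induction k arbitrary: n)
  case (Suc k)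
  thus ?case unfolding power_Suc by (intro fps_mult_nth_cong) auto
qed simp

lemma overpartition_fps_mult_theta_fps: "overpartition_fps * theta_fps = 1"
proof (rule fps_ext)
  fix n
  let ?G = bounded_overpartition_fps
  have "(fps_X :: int fps) ^ Suc m \<noteq> 1" for m
    by (metis fps_X_power_nth fps_one_nth nat.distinct(1) zero_neq_one)
  hence id: "?G n * (1 + (\<Sum>j=1..n. 2 * (-1) ^ j * fps_X ^ j\<^sup>2))
    = 1 + (\<Sum>s<n. (-1) ^ Suc s * fps_X ^ (Suc s * Suc n) * (?G (Suc s) + ?G s))"
    by (intro finite_Gauss_square_identity bounded_overpartition_fps_0 bounded_overpartition_fps_Suc)
  \<comment> \<open>The exponent \<open>Suc s * Suc n\<close> exceeds \<open>n\<close>, so no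
    correction term reaches coefficient \<open>n\<close>.\<close>
  have high: "((-1) ^ Suc s * fps_X ^ (Suc s * Suc n) * (?G (Suc s) + ?G s)) $ n = 0" for s
  proof -
    have "(fps_X ^ (Suc s * Suc n) * ((-1) ^ Suc s * (?G (Suc s) + ?G s))) $ n = 0"
      by (subst fps_X_power_mult_nth) simp
    thus ?thesis by (simp only: mult_ac)
  qed
  have "(overpartition_fps * theta_fps) $ n
      = (?G n * (1 + (\<Sum>j=1..n. 2 * (-1) ^ j * fps_X ^ j\<^sup>2))) $ n"
    by (intro fps_mult_nth_cong theta_fps_nth_eq_partial_sum)
       (simp_all add: overpartition_fps_def bounded_overpartition_fps_def overpartition_count_def
          bounded_overpartitions_eq_overpartitions)
  also have "\<dots> = 1 $ n"
    unfolding id fps_add_nth fps_sum_nth high by simp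
  finally show "(overpartition_fps * theta_fps) $ n = 1 $ n" .
qed

lemma theta_fps_power_nth: "(theta_fps ^ k) $ n = (-1) ^ n * int (sq_reps k n)"
proof (induction k arbitrary: n)
  case 0
  have "{x :: nat \<Rightarrow> int. \<forall>i. x i = 0} = {\<lambda>_. 0}" by auto
  thus ?case by (simp add: sq_reps_def)
next
  case (Suc k)
  have nth: "theta_fps $ i = (-1) ^ i * int (card {j::int. j\<^sup>2 = int i})" for i
    by (simp add: theta_fps_def)
  have "(theta_fps ^ Suc k) $ n = (\<Sum>i\<le>n. theta_fps $ i * (theta_fps ^ k) $ (n - i))"
    by (simp add: fps_mult_nth atLeast0AtMost)
  also have "\<dots> = (\<Sum>i\<le>n. (-1) ^ (i + (n - i)) * int (card {j::int. j\<^sup>2 = int i} * sq_reps k (n - i)))"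
    by (intro sum.cong refl) (simp add: Suc.IH nth flip: power_add)
  also have "\<dots> = (-1) ^ n * int (sq_reps (Suc k) n)"
    by (simp add: sq_reps_Suc sum_distrib_left)
  finally show ?case .
qed

section \<open>The congruence\<close>

text \<open>Turns coefficientwise congruences into divisibility of series, which survives
  multiplication by a series.\<close>

lemma fps_const_dvd_iff:
  fixes A :: "'a::comm_semiring_1 fps"
  shows "fps_const c dvd A \<longleftrightarrow> (\<forall>n. c dvd A $ n)"
proof
  assume "\<forall>n. c dvd A $ n"
  then obtain f where "\<And>n. A $ n = c * f n" unfolding dvd_def by metis
  hence "A = fps_const c * Abs_fps f" by (intro fps_ext) simp
  thus "fps_const c dvd A" by (rule dvdI)
next
  assume "fps_const c dvd A"
  then obtain B where "A = fps_const c * B" by (rule dvdE)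
  thus "\<forall>n. c dvd A $ n" by simp
qed

text \<open>The inner binomial coefficients 5, 10, 10, 5 are multiples of 5.\<close>

lemma dvd_power5_sum_minus_sum_power5:
  fixes f :: "'a \<Rightarrow> 'b::comm_ring_1"
  shows "finite A \<Longrightarrow> 5 dvd (\<Sum>x\<in>A. f x) ^ 5 - (\<Sum>x\<in>A. f x ^ 5)"
proof (induction A rule: finite_induct)
  case (insert x A)
  define y where "y = (\<Sum>x\<in>A. f x)"
  have "(f x + y) ^ 5 = f x ^ 5 + 5 * (f x ^ 4 * y + 2 * f x ^ 3 * y ^ 2 + 2 * f x ^ 2 * y ^ 3
      + f x * y ^ 4) + y ^ 5"
    by (simp add: power4_eq_xxxx power3_eq_cube power2_eq_square power_numeral_odd Let_def algebra_simps)
  hence "(f x + y) ^ 5 - (f x ^ 5 + (\<Sum>x\<in>A. f x ^ 5)) =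
     5 * (f x ^ 4 * y + 2 * f x ^ 3 * y ^ 2 + 2 * f x ^ 2 * y ^ 3 + f x * y ^ 4)
     + (y ^ 5 - (\<Sum>x\<in>A. f x ^ 5))"
    by simp
  moreover have "5 dvd \<dots>"
    using insert.IH by (intro dvd_add dvd_triv_left) (simp add: y_def)
  ultimately have "5 dvd (f x + y) ^ 5 - (f x ^ 5 + (\<Sum>x\<in>A. f x ^ 5))"
    by (simp only:)
  thus ?case
    using insert.hyps by (simp add: y_def)
qed simp

text \<open>Modulo 5 the fifth power acts termwise, sending \<open>c q^(j^2)\<close> to
  \<open>c^5 q^(5 j^2)\<close>, and \<open>c^5\<close> is congruent to \<open>c\<close>.\<close>

lemma theta_fps_power5_nth_cong:
  "[(theta_fps ^ 5) $ n = (if 5 dvd n then theta_fps $ (n div 5) else 0)] (mod 5)"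
proof -
  define c :: "nat \<Rightarrow> int" where "c j = (if j = 0 then 1 else 2 * (-1) ^ j)" for j
  define h :: "nat \<Rightarrow> int fps" where "h j = fps_const (c j) * fps_X ^ j\<^sup>2" for j
  have theta: "theta_fps $ i = (\<Sum>j=0..n. h j) $ i" if "i \<le> n" for i
  proof -
    have "(\<Sum>j=1..n. 2 * (-1) ^ j * fps_X ^ j\<^sup>2) = (\<Sum>j=1..n. h j)"
      by (intro sum.cong) (auto simp: h_def c_def fps_const_two_minus_one_power)
    hence "1 + (\<Sum>j=1..n. 2 * (-1) ^ j * fps_X ^ j\<^sup>2) = (\<Sum>j=0..n. h j)"
      by (simp add: sum.atLeast_Suc_atMost h_def c_def)
    thus ?thesis using theta_fps_nth_eq_partial_sum[OF that] by simp
  qed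
  have h5: "[(h j ^ 5) $ n = (if 5 dvd n then h j $ (n div 5) else 0)] (mod 5)" for j
  proof -
    have "[c j ^ 5 = c j] (mod 5)"
      by (auto simp: c_def power_mult_distrib cong_def minus_one_power_iff)
    moreover have "(h j ^ 5) $ n = (if n = 5 * j\<^sup>2 then c j ^ 5 else 0)"
    proof -
      have "h j ^ 5 = fps_const (c j ^ 5) * fps_X ^ (5 * j\<^sup>2)"
        by (simp add: h_def power_mult_distrib mult.commute flip: power_mult)
      thus ?thesis by (simp add: fps_X_power_iff)
    qed
    moreover have "(if 5 dvd n then h j $ (n div 5) else 0) = (if n = 5 * j\<^sup>2 then c j else 0)"
      by (auto simp: h_def fps_X_power_iff)
    ultimately show ?thesis by simp
  qed
  have "(theta_fps ^ 5) $ n = ((\<Sum>j=0..n. h j) ^ 5) $ n"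
    by (intro fps_power_nth_cong theta)
  also have "[\<dots> = (\<Sum>j=0..n. h j ^ 5) $ n] (mod 5)"
    using dvd_power5_sum_minus_sum_power5[of "{0..n}" h]
    by (simp add: cong_iff_dvd_diff fps_const_dvd_iff numeral_fps_const)
  also have "(\<Sum>j=0..n. h j ^ 5) $ n = (\<Sum>j=0..n. (h j ^ 5) $ n)"
    by (rule fps_sum_nth)
  also have "[\<dots> = (\<Sum>j=0..n. if 5 dvd n then h j $ (n div 5) else 0)] (mod 5)"
    by (intro cong_sum h5)
  \<comment> \<open>The truncation at \<open>n\<close> is also valid at the index
    \<open>n div 5\<close>.\<close>
  also have "(\<Sum>j=0..n. if 5 dvd n then h j $ (n div 5) else 0)
      = (if 5 dvd n then theta_fps $ (n div 5) else 0)"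
    by (simp add: theta fps_sum_nth)
  finally show ?thesis .
qed

theorem theorem1:
  fixes n :: nat
  assumes "n \<ge> 1"
  shows "[int (overpartition_count (5 * n)) = (-1) ^ n * int (sq_reps 3 n)] (mod 5)"
proof -
  let ?P = overpartition_fps and ?T = theta_fps
  define Q where "Q = Abs_fps (\<lambda>n. int (overpartition_count (5 * n)))"
  have "5 dvd (Q * ?T - ?T ^ 4) $ m" for m
  proof -
    have "(?P * ?T ^ 5) $ (5 * m) = (?T ^ 4) $ (5 * m)"
      using overpartition_fps_mult_theta_fps
      by (simp add: eval_nat_numeral flip: mult.assoc)
    moreover have "[(?P * ?T ^ 5) $ (5 * m) = (Q * ?T) $ m] (mod 5)"
    proof -
      have "(?P * ?T ^ 5) $ (5 * m) = (\<Sum>i=0..5 * m. ?P $ i * (?T ^ 5) $ (5 * m - i))"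
        by (rule fps_mult_nth)
      also have "[\<dots> = (\<Sum>i=0..5 * m. ?P $ i *
          (if 5 dvd 5 * m - i then ?T $ ((5 * m - i) div 5) else 0))] (mod 5)"
        by (intro cong_sum cong_mult theta_fps_power5_nth_cong cong_refl)
      \<comment> \<open>As \<open>5 dvd 5 * m - i\<close> forces \<open>5 dvd i\<close>, only
        overpartition numbers of multiples of 5 survive.\<close>
      also have "(\<Sum>i=0..5 * m. ?P $ i * (if 5 dvd 5 * m - i then ?T $ ((5 * m - i) div 5) else 0))
          = (\<Sum>i\<in>(*) 5 ` {0..m}. ?P $ i * ?T $ ((5 * m - i) div 5))"
      proof (rule sum.mono_neutral_cong_right)
        show "\<forall>i\<in>{0..5 * m} - (*) 5 ` {0..m}.
            ?P $ i * (if 5 dvd 5 * m - i then ?T $ ((5 * m - i) div 5) else 0) = 0"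
        proof
          fix i assume i: "i \<in> {0..5 * m} - (*) 5 ` {0..m}"
          have "\<not> 5 dvd 5 * m - i"
          proof
            assume "5 dvd 5 * m - i"
            hence "5 dvd i" using i by (metis DiffD1 atLeastAtMost_iff dvd_diffD1 dvd_triv_left)
            with i show False by (auto elim!: dvdE)
          qed
          thus "?P $ i * (if 5 dvd 5 * m - i then ?T $ ((5 * m - i) div 5) else 0) = 0" by simp
        qed
      qed (auto simp flip: right_diff_distrib')
      also have "\<dots> = (Q * ?T) $ m"
        by (subst sum.reindex)
           (auto simp: inj_on_def fps_mult_nth Q_def overpartition_fps_def simp flip: right_diff_distrib'
              intro!: sum.cong)
      finally show ?thesis .
    qed
    moreover have "[(?T ^ 4) $ (5 * m) = (?T ^ 4) $ m] (mod 5)"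
    proof -
      have "(-1 :: int) ^ (5 * m) = (-1) ^ m" by (simp add: minus_one_power_iff)
      moreover have "[int (sq_reps 4 (5 * m)) = int (sq_reps 4 m)] (mod 5)"
        using sq_reps_4_cong[of m] by (metis cong_int_iff of_nat_numeral)
      ultimately show ?thesis
        unfolding theta_fps_power_nth by (simp add: cong_mult)
    qed
    ultimately have "[(Q * ?T) $ m = (?T ^ 4) $ m] (mod 5)"
      by (metis cong_sym cong_trans)
    thus ?thesis by (simp add: cong_iff_dvd_diff)
  qed
  hence "fps_const 5 dvd Q * ?T - ?T ^ 4"
    by (simp add: fps_const_dvd_iff)
  \<comment> \<open>Multiplying by \<open>?P\<close>, the inverse of \<open>?T\<close>, cancels the
    common factor \<open>?T\<close>.\<close>
  hence "fps_const 5 dvd ?P * (Q * ?T - ?T ^ 4)"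
    by (rule dvd_mult)
  also have "?P * (Q * ?T - ?T ^ 4) = (?P * ?T) * (Q - ?T ^ 3)"
    by (simp add: algebra_simps eval_nat_numeral)
  also have "\<dots> = Q - ?T ^ 3"
    by (simp add: overpartition_fps_mult_theta_fps)
  finally have "5 dvd (Q - ?T ^ 3) $ n"
    by (simp only: fps_const_dvd_iff)
  thus ?thesis
    by (simp add: Q_def theta_fps_power_nth cong_iff_dvd_diff)
qed

end
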